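(* Let $\hat\Pi_t=\hat\sigma_t(M_t)$, $t=0,\dots,T$, be an approximate information state, with parameters $\epsilon_T$ and $\delta_t$ ($t=0,\dots,T-1$), for the terminal-cost minimax control problem described in the context. For $t=0,\dots,T-1$ let $L_{\hat V_{t+1}}$ be a Lipschitz constant of $\hat V_{t+1}(\cdot)$. Let $\hat g_t(\hat\pi_t)\in\arg\min_{u_t\in\mathcal{U}_t}\hat Q_t(\hat\pi_t,u_t)$ and $g_t(m_t):=\hat g_t(\hat\sigma_t(m_t))$ for $t=0,\dots,T$, and let $\Theta_t,\Lambda_t$ be the functions evaluating the strategy $(g_0,\dots,g_T)$ defined in the context. Then, for all $t=0,\dots,T$, all $m_t\in\mathcal{M}_t$ and all $u_t\in\mathcal{U}_t$, $$|Q_t(m_t,u_t)-\Theta_t(m_t,u_t)|\le2\alpha_t,\qquad |V_t(m_t)-\Lambda_t(m_t)|\le2\alpha_t,$$ where $\alpha_T=\epsilon_T$ and $\alpha_t=\alpha_{t+1}+L_{\hat V_{t+1}}\cdot\delta_t$ for all $t=0,\dots,T-1$.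
   Context: System. Fix a horizon $T\in\mathbb{N}$ and finite nonempty sets $\mathcal{X}_t,\mathcal{U}_t,\mathcal{W}_t,\mathcal{N}_t,\mathcal{Y}_t$ ($t=0,\dots,T$). The state evolves as $X_{t+1}=f_t(X_t,U_t,W_t)\in\mathcal{X}_{t+1}$ for $t=0,\dots,T-1$ from $X_0\in\mathcal{X}_0$, with disturbance $W_t\in\mathcal{W}_t$ and action $U_t\in\mathcal{U}_t$; the observation is $Y_t=h_t(X_t,N_t)\in\mathcal{Y}_t$ with noise $N_t\in\mathcal{N}_t$. The primitive variables $X_0,W_t,N_t$ are independent in the non-stochastic sense: their joint range is the full product $\mathcal{X}_0\times\prod_t\mathcal{W}_t\times\prod_t\mathcal{N}_t$. The memory at time $t$ is $M_t=(Y_{0:t},U_{0:t-1})$, where $Y_{0:t}=(Y_0,\dots,Y_t)$. The terminal cost is $c_T(X_T,U_T)$ with $c_T:\mathcal{X}_T\times\mathcal{U}_T\to\mathbb{R}_{\ge 0}$. Ranges. All quantities are uncertain variables, i.e. functions on a sample space $\Omega$ without any probability distribution. Here $\Omega$ is the set of all tuples $\omega=(x_0,w_{0:T},n_{0:T},u_{0:T})$ with $x_0\in\mathcal{X}_0$, $w_t\in\mathcal{W}_t$, $n_t\in\mathcal{N}_t$, $u_t\in\mathcal{U}_t$ (actions arbitrary). The conditional range of $X$ given a realization $y$ of $Y$ is $[[X|y]]:=\{X(\omega): \omega\in\Omega,\ Y(\omega)=y\}$; similarly when conditioning on several realizations jointly. $\mathcal{M}_t$ is the set of realizations of $M_t$,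 $\mathcal{M}_t=\{M_t(\omega):\omega\in\Omega\}$. Hausdorff metric. For nonempty finite subsets $\mathcal{A},\mathcal{B}$ of a metric space with metric $d$, $\mathcal{H}(\mathcal{A},\mathcal{B}):=\max\{\max_{a\in\mathcal{A}}\min_{b\in\mathcal{B}}d(a,b),\ \max_{b\in\mathcal{B}}\min_{a\in\mathcal{A}}d(a,b)\}$. Memory-based value functions. $Q_T(m_T,u_T):=\max_{x_T\in[[X_T|m_T]]}c_T(x_T,u_T)$; for $t=0,\dots,T-1$, $Q_t(m_t,u_t):=\max_{m_{t+1}\in[[M_{t+1}|m_t,u_t]]}V_{t+1}(m_{t+1})$; and $V_t(m_t):=\min_{u_t\in\mathcal{U}_t}Q_t(m_t,u_t)$ for $t=0,\dots,T$. Approximate information state. A family $\hat\Pi_t=\hat\sigma_t(M_t)$, $t=0,\dots,T$, with $\hat\sigma_t:\mathcal{M}_t\to\hat{\mathcal{P}}_t$ and $\hat{\mathcal{P}}_t$ a finite metric space, is an approximate information state with parameters $\epsilon_T,\delta_t\in\mathbb{R}_{\ge0}$ if: (1) for all $m_T\in\mathcal{M}_T$, $u_T\in\mathcal{U}_T$, $|\max_{x_T\in[[X_T|m_T]]}c_T(x_T,u_T)-\max_{x_T\in[[X_T|\hat\sigma_T(m_T)]]}c_T(x_T,u_T)|\le\epsilon_T$, where $[[X_T|\hat\pi_T]]$ is the conditional range given $\hat\Pi_T=\hat\pi_T$; (2) for all $t=0,\dots,T-1$, $m_t\in\mathcal{M}_t$, $u_t\in\mathcal{U}_t$, $\mathcal{H}\big([[\hat\Pi_{t+1}|m_t,u_t]],[[\hat\Pi_{t+1}|\hat\sigma_t(m_t),u_t]]\big)\le\delta_t$,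 where the second set conditions on $\hat\Pi_t=\hat\sigma_t(m_t)$ and $U_t=u_t$. Approximate value functions (for $\hat\pi_t$ in the range of $\hat\Pi_t$). $\hat Q_T(\hat\pi_T,u_T):=\max_{x_T\in[[X_T|\hat\pi_T]]}c_T(x_T,u_T)$; for $t=0,\dots,T-1$, $\hat Q_t(\hat\pi_t,u_t):=\max_{\hat\pi_{t+1}\in[[\hat\Pi_{t+1}|\hat\pi_t,u_t]]}\hat V_{t+1}(\hat\pi_{t+1})$; and $\hat V_t(\hat\pi_t):=\min_{u_t\in\mathcal{U}_t}\hat Q_t(\hat\pi_t,u_t)$ for $t=0,\dots,T$. Evaluation of the strategy $g=(g_0,\dots,g_T)$. $\Theta_T(m_T,u_T):=\max_{x_T\in[[X_T|m_T]]}c_T(x_T,u_T)$; for $t=0,\dots,T-1$, $\Theta_t(m_t,u_t):=\max_{m_{t+1}\in[[M_{t+1}|m_t,u_t]]}\Lambda_{t+1}(m_{t+1})$; and $\Lambda_t(m_t):=\Theta_t(m_t,g_t(m_t))$ for $t=0,\dots,T$. *)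

theory Defs
  imports "HOL-Analysis.Abstract_Metric_Spaces" "HOL-Library.FuncSet"
begin

section \<open>The uncertain system\<close>

text \<open>Spaces at different times are subsets of one type per kind of variable; as they may be
  arbitrary subsets, unrelated spaces can be taken inside a disjoint union.\<close>

record ('x, 'u, 'w, 'n, 'y) control_system =
  horizon :: nat
  states :: "nat \<Rightarrow> 'x set"
  actions :: "nat \<Rightarrow> 'u set"
  disturbances :: "nat \<Rightarrow> 'w set"
  noises :: "nat \<Rightarrow> 'n set"
  observations :: "nat \<Rightarrow> 'y set"
  dynamics :: "nat \<Rightarrow> 'x \<Rightarrow> 'u \<Rightarrow> 'w \<Rightarrow> 'x"
  obs_map :: "nat \<Rightarrow> 'x \<Rightarrow> 'n \<Rightarrow> 'y"
  terminal_cost :: "'x \<Rightarrow> 'u \<Rightarrow> real"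

definition valid_system :: "('x, 'u, 'w, 'n, 'y) control_system \<Rightarrow> bool" where
  "valid_system S \<longleftrightarrow>
     (\<forall>t\<le>horizon S.
        finite (states S t) \<and> states S t \<noteq> {} \<and>
        finite (actions S t) \<and> actions S t \<noteq> {} \<and>
        finite (disturbances S t) \<and> disturbances S t \<noteq> {} \<and>
        finite (noises S t) \<and> noises S t \<noteq> {} \<and>
        finite (observations S t) \<and> observations S t \<noteq> {}) \<and>
     (\<forall>t<horizon S. \<forall>x\<in>states S t. \<forall>u\<in>actions S t. \<forall>w\<in>disturbances S t.
        dynamics S t x u w \<in> states S (Suc t)) \<and>
     (\<forall>t\<le>horizon S. \<forall>x\<in>states S t. \<forall>n\<in>noises S t. obs_map S t x n \<in> observations S t) \<and>
     (\<forall>x\<in>states S (horizon S). \<forall>u\<in>actions S (horizon S). 0 \<le> terminal_cost S x u)"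

text \<open>An outcome is a tuple \<open>(x\<^sub>0, w, n, u)\<close>. Since the sample space is the full product (with
  finite sequences as extensional functions on \<open>{0..horizon}\<close>), the primitive variables are
  independent in the non-stochastic sense.\<close>

type_synonym ('x, 'u, 'w, 'n) outcome =
  "'x \<times> (nat \<Rightarrow> 'w) \<times> (nat \<Rightarrow> 'n) \<times> (nat \<Rightarrow> 'u)"

definition sample_space ::
  "('x, 'u, 'w, 'n, 'y) control_system \<Rightarrow> ('x, 'u, 'w, 'n) outcome set" where
  "sample_space S =
     states S 0 \<times> (\<Pi>\<^sub>E t\<in>{0..horizon S}. disturbances S t) \<times>
     (\<Pi>\<^sub>E t\<in>{0..horizon S}. noises S t) \<times> (\<Pi>\<^sub>E t\<in>{0..horizon S}. actions S t)"

fun action :: "nat \<Rightarrow> ('x, 'u, 'w, 'n) outcome \<Rightarrow> 'u" where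
  "action t (x0, w, n, u) = u t"

fun state ::
  "('x, 'u, 'w, 'n, 'y) control_system \<Rightarrow> nat \<Rightarrow> ('x, 'u, 'w, 'n) outcome \<Rightarrow> 'x" where
  "state S 0 (x0, w, n, u) = x0"
| "state S (Suc t) (x0, w, n, u) = dynamics S t (state S t (x0, w, n, u)) (u t) (w t)"

fun obs ::
  "('x, 'u, 'w, 'n, 'y) control_system \<Rightarrow> nat \<Rightarrow> ('x, 'u, 'w, 'n) outcome \<Rightarrow> 'y" where
  "obs S t (x0, w, n, u) = obs_map S t (state S t (x0, w, n, u)) (n t)"

type_synonym ('u, 'y) memory = "'y list \<times> 'u list"

definition memory ::
  "('x, 'u, 'w, 'n, 'y) control_system \<Rightarrow> nat \<Rightarrow> ('x, 'u, 'w, 'n) outcome \<Rightarrow> ('u, 'y) memory" where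
  "memory S t \<omega> = (map (\<lambda>s. obs S s \<omega>) [0..<Suc t], map (\<lambda>s. action s \<omega>) [0..<t])"

definition memories ::
  "('x, 'u, 'w, 'n, 'y) control_system \<Rightarrow> nat \<Rightarrow> ('u, 'y) memory set" where
  "memories S t = memory S t ` sample_space S"

text \<open>The conditional range \<open>[[A | b]]\<close> of \<open>A\<close> given \<open>B = b\<close>; joint conditioning uses a
  pair-valued \<open>B\<close>.\<close>

definition cond_range ::
  "('x, 'u, 'w, 'n, 'y) control_system \<Rightarrow> (('x, 'u, 'w, 'n) outcome \<Rightarrow> 'a) \<Rightarrow>
   (('x, 'u, 'w, 'n) outcome \<Rightarrow> 'b) \<Rightarrow> 'b \<Rightarrow> 'a set" where
  "cond_range S A B b = {A \<omega> |\<omega>. \<omega> \<in> sample_space S \<and> B \<omega> = b}"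


section \<open>Memory-based value functions\<close>

text \<open>In the backward recursions below, times beyond the horizon are treated like the horizon;
  these values are never used.\<close>

function Q_fun ::
    "('x, 'u, 'w, 'n, 'y) control_system \<Rightarrow> nat \<Rightarrow> ('u, 'y) memory \<Rightarrow> 'u \<Rightarrow> real"
  and V_fun ::
    "('x, 'u, 'w, 'n, 'y) control_system \<Rightarrow> nat \<Rightarrow> ('u, 'y) memory \<Rightarrow> real" where
  "Q_fun S t m u =
     (if t < horizon S
      then MAX m' \<in> cond_range S (memory S (Suc t)) (\<lambda>\<omega>. (memory S t \<omega>, action t \<omega>)) (m, u).
             V_fun S (Suc t) m'
      else MAX x \<in> cond_range S (state S t) (memory S t) m. terminal_cost S x u)"
| "V_fun S t m = (MIN u \<in> actions S t. Q_fun S t m u)"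
  by pat_completeness auto
termination
  by (relation "measure (\<lambda>z. case z of Inl (S, t, _) \<Rightarrow> 2 * (horizon S - t)
                                     | Inr (S, t, _) \<Rightarrow> Suc (2 * (horizon S - t)))") auto

declare Q_fun.simps [simp del] V_fun.simps [simp del]


section \<open>Approximate information states\<close>

text \<open>Only meaningful for nonempty finite \<open>A\<close> and \<open>B\<close>.\<close>

definition hausdorff :: "'p metric \<Rightarrow> 'p set \<Rightarrow> 'p set \<Rightarrow> real" where
  "hausdorff P A B =
     max (MAX a\<in>A. MIN b\<in>B. mdist P a b) (MAX b\<in>B. MIN a\<in>A. mdist P a b)"

definition info ::
  "('x, 'u, 'w, 'n, 'y) control_system \<Rightarrow> (nat \<Rightarrow> ('u, 'y) memory \<Rightarrow> 'p) \<Rightarrow>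
   nat \<Rightarrow> ('x, 'u, 'w, 'n) outcome \<Rightarrow> 'p" where
  "info S \<sigma> t \<omega> = \<sigma> t (memory S t \<omega>)"

definition info_range ::
  "('x, 'u, 'w, 'n, 'y) control_system \<Rightarrow> (nat \<Rightarrow> ('u, 'y) memory \<Rightarrow> 'p) \<Rightarrow> nat \<Rightarrow> 'p set" where
  "info_range S \<sigma> t = info S \<sigma> t ` sample_space S"

definition approx_info_state ::
  "('x, 'u, 'w, 'n, 'y) control_system \<Rightarrow> (nat \<Rightarrow> 'p metric) \<Rightarrow>
   (nat \<Rightarrow> ('u, 'y) memory \<Rightarrow> 'p) \<Rightarrow> real \<Rightarrow> (nat \<Rightarrow> real) \<Rightarrow> bool" where
  "approx_info_state S P \<sigma> \<epsilon> \<delta> \<longleftrightarrow>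
     (\<forall>t\<le>horizon S. finite (mspace (P t)) \<and> \<sigma> t \<in> memories S t \<rightarrow> mspace (P t)) \<and>
     0 \<le> \<epsilon> \<and> (\<forall>t<horizon S. 0 \<le> \<delta> t) \<and>
     (let T = horizon S in
        \<forall>m\<in>memories S T. \<forall>u\<in>actions S T.
          \<bar>(MAX x \<in> cond_range S (state S T) (memory S T) m. terminal_cost S x u)
           - (MAX x \<in> cond_range S (state S T) (info S \<sigma> T) (\<sigma> T m). terminal_cost S x u)\<bar> \<le> \<epsilon>) \<and>
     (\<forall>t<horizon S. \<forall>m\<in>memories S t. \<forall>u\<in>actions S t.
        hausdorff (P (Suc t))
          (cond_range S (info S \<sigma> (Suc t)) (\<lambda>\<omega>. (memory S t \<omega>, action t \<omega>)) (m, u))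
          (cond_range S (info S \<sigma> (Suc t)) (\<lambda>\<omega>. (info S \<sigma> t \<omega>, action t \<omega>)) (\<sigma> t m, u))
        \<le> \<delta> t)"

function Q_hat ::
    "('x, 'u, 'w, 'n, 'y) control_system \<Rightarrow> (nat \<Rightarrow> ('u, 'y) memory \<Rightarrow> 'p) \<Rightarrow>
     nat \<Rightarrow> 'p \<Rightarrow> 'u \<Rightarrow> real"
  and V_hat ::
    "('x, 'u, 'w, 'n, 'y) control_system \<Rightarrow> (nat \<Rightarrow> ('u, 'y) memory \<Rightarrow> 'p) \<Rightarrow>
     nat \<Rightarrow> 'p \<Rightarrow> real" where
  "Q_hat S \<sigma> t \<pi> u =
     (if t < horizon S
      then MAX \<pi>' \<in> cond_range S (info S \<sigma> (Suc t)) (\<lambda>\<omega>. (info S \<sigma> t \<omega>, action t \<omega>)) (\<pi>, u).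
             V_hat S \<sigma> (Suc t) \<pi>'
      else MAX x \<in> cond_range S (state S t) (info S \<sigma> t) \<pi>. terminal_cost S x u)"
| "V_hat S \<sigma> t \<pi> = (MIN u \<in> actions S t. Q_hat S \<sigma> t \<pi> u)"
  by pat_completeness auto
termination
  by (relation "measure (\<lambda>z. case z of Inl (S, _, t, _) \<Rightarrow> 2 * (horizon S - t)
                                     | Inr (S, _, t, _) \<Rightarrow> Suc (2 * (horizon S - t)))") auto

declare Q_hat.simps [simp del] V_hat.simps [simp del]

text \<open>Nonnegativity matters: on a one-point set the inequality alone would admit every \<open>L\<close>.\<close>

definition lipschitz_const :: "'p metric \<Rightarrow> 'p set \<Rightarrow> real \<Rightarrow> ('p \<Rightarrow> real) \<Rightarrow> bool" where
  "lipschitz_const P A L F \<longleftrightarrow>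
     0 \<le> L \<and> (\<forall>p\<in>A. \<forall>q\<in>A. \<bar>F p - F q\<bar> \<le> L * mdist P p q)"


section \<open>Evaluation of a memory-based strategy\<close>

function Theta ::
    "('x, 'u, 'w, 'n, 'y) control_system \<Rightarrow> (nat \<Rightarrow> ('u, 'y) memory \<Rightarrow> 'u) \<Rightarrow>
     nat \<Rightarrow> ('u, 'y) memory \<Rightarrow> 'u \<Rightarrow> real"
  and Lambda ::
    "('x, 'u, 'w, 'n, 'y) control_system \<Rightarrow> (nat \<Rightarrow> ('u, 'y) memory \<Rightarrow> 'u) \<Rightarrow>
     nat \<Rightarrow> ('u, 'y) memory \<Rightarrow> real" where
  "Theta S g t m u =
     (if t < horizon S
      then MAX m' \<in> cond_range S (memory S (Suc t)) (\<lambda>\<omega>. (memory S t \<omega>, action t \<omega>)) (m, u).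
             Lambda S g (Suc t) m'
      else MAX x \<in> cond_range S (state S t) (memory S t) m. terminal_cost S x u)"
| "Lambda S g t m = Theta S g t m (g t m)"
  by pat_completeness auto
termination
  by (relation "measure (\<lambda>z. case z of Inl (S, _, t, _) \<Rightarrow> 2 * (horizon S - t)
                                     | Inr (S, _, t, _) \<Rightarrow> Suc (2 * (horizon S - t)))") auto

declare Theta.simps [simp del] Lambda.simps [simp del]

end

theory Submission
  imports Defs
begin

text \<open>Both the optimal values (\<open>Q_fun\<close>, \<open>V_fun\<close>) and those of the strategy (\<open>Theta\<close>, \<open>Lambda\<close>) stay
  within \<open>\<alpha> t\<close> of the approximate values at the information state, for the same reason: one
  backward step maximises over successor memories, whose information states form a set that is
  \<open>\<delta> t\<close>-close in Hausdorff distance to the one defining \<open>Q_hat\<close>, so it adds at most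
  \<open>L (Suc t) * \<delta> t\<close>. Passing from actions to values is a minimum on both sides for \<open>V_fun\<close>, whereas
  for \<open>Lambda\<close> the action used is a minimiser of \<open>Q_hat\<close>. The factor 2 is the triangle
  inequality.\<close>

text \<open>Each value on \<open>A\<close> is dominated, up to \<open>c\<close>, by one on
  \<open>B\<close>, and hence by the maximum over \<open>B\<close>. Using two index sets covers both
  perturbation of a function on one set (take b = a) and Hausdorff matching (take b close to a).
  That \<open>B\<close> is nonempty follows from the last assumption, since \<open>A\<close>
  is.\<close>

lemma Max_image_le_Max_image_add:
  fixes f :: "'a \<Rightarrow> real" and h :: "'b \<Rightarrow> real"
  assumes "finite A" "A \<noteq> {}" "finite B"
    and "\<And>a. a \<in> A \<Longrightarrow> \<exists>b\<in>B. f a \<le> h b + c"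
  shows "Max (f ` A) \<le> Max (h ` B) + c"
proof -
  have "f a \<le> Max (h ` B) + c" if a: "a \<in> A" for a
  proof -
    obtain b where b: "b \<in> B" "f a \<le> h b + c"
      using assms(4)[OF a] by blast
    have "h b \<le> Max (h ` B)"
      using b(1) assms(3) by simp
    with b(2) show ?thesis by linarith
  qed
  with assms show ?thesis by simp
qed

lemma abs_Max_image_diff_le:
  fixes f h :: "'a \<Rightarrow> real"
  assumes "finite A" "A \<noteq> {}" and close: "\<And>a. a \<in> A \<Longrightarrow> \<bar>f a - h a\<bar> \<le> c"
  shows "\<bar>Max (f ` A) - Max (h ` A)\<bar> \<le> c"
proof -
  have "Max (f ` A) \<le> Max (h ` A) + c" "Max (h ` A) \<le> Max (f ` A) + c"
    using assms(1,2) close by (intro Max_image_le_Max_image_add; force)+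
  then show ?thesis by linarith
qed

lemma abs_Min_image_diff_le:
  fixes f h :: "'a \<Rightarrow> real"
  assumes "finite A" "A \<noteq> {}" and close: "\<And>a. a \<in> A \<Longrightarrow> \<bar>f a - h a\<bar> \<le> c"
  shows "\<bar>Min (f ` A) - Min (h ` A)\<bar> \<le> c"
proof -
  have le: "Min (f' ` A) \<le> Min (h' ` A) + c"
    if "\<And>a. a \<in> A \<Longrightarrow> f' a \<le> h' a + c" for f' h' :: "'a \<Rightarrow> real"
  proof -
    \<comment> \<open>The point attaining the minimum of \<open>h'\<close> is the test point that
      bounds the minimum of \<open>f'\<close>.\<close>
    have "Min (h' ` A) \<in> h' ` A"
      using assms(1,2) by (intro Min_in) auto
    then obtain a where a: "a \<in> A" "Min (h' ` A) = h' a" by blast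
    have "Min (f' ` A) \<le> f' a"
      using a(1) assms(1) by simp
    with a that[OF a(1)] show ?thesis by simp
  qed
  have "Min (f ` A) \<le> Min (h ` A) + c" "Min (h ` A) \<le> Min (f ` A) + c"
    using close by (intro le; force)+
  then show ?thesis by linarith
qed

lemma hausdorff_leD:
  assumes "finite A" "A \<noteq> {}" "finite B" "B \<noteq> {}" "hausdorff P A B \<le> d"
  shows "a \<in> A \<Longrightarrow> \<exists>b\<in>B. mdist P a b \<le> d"
    and "b \<in> B \<Longrightarrow> \<exists>a\<in>A. mdist P a b \<le> d"
  using assms by (auto simp: hausdorff_def Min_le_iff)

text \<open>A maximiser on either set has a partner in the other within \<open>d\<close>, and the
  Lipschitz bound carries its value over with error at most \<open>L * d\<close>.\<close>

lemma abs_Max_image_diff_le_hausdorff: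
  fixes F :: "'p \<Rightarrow> real"
  assumes fin: "finite A" "A \<noteq> {}" "finite B" "B \<noteq> {}"
    and haus: "hausdorff P A B \<le> d"
    and lip: "lipschitz_const P D L F" and sub: "A \<subseteq> D" "B \<subseteq> D"
  shows "\<bar>Max (F ` A) - Max (F ` B)\<bar> \<le> L * d"
proof -
  have close: "\<bar>F a - F b\<bar> \<le> L * d" if "a \<in> A" "b \<in> B" "mdist P a b \<le> d" for a b
  proof -
    have "\<bar>F a - F b\<bar> \<le> L * mdist P a b"
      using lip sub that(1,2) by (auto simp: lipschitz_const_def)
    \<comment> \<open>Multiplying the distance bound by \<open>L\<close> preserves the inequality
      because \<open>lipschitz_const\<close> includes 0 \<le> \<open>L\<close>.\<close>
    also have "\<dots> \<le> L * d"
      using lip that(3) by (intro mult_left_mono) (auto simp: lipschitz_const_def)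
    finally show ?thesis .
  qed
  have "Max (F ` A) \<le> Max (F ` B) + L * d"
  proof (rule Max_image_le_Max_image_add)
    fix a assume a: "a \<in> A"
    then obtain b where b: "b \<in> B" "mdist P a b \<le> d"
      using hausdorff_leD(1)[OF fin haus] by blast
    have "F a \<le> F b + L * d"
      using close[OF a b] by linarith
    with b(1) show "\<exists>b\<in>B. F a \<le> F b + L * d" by blast
  qed (use fin in auto)
  moreover have "Max (F ` B) \<le> Max (F ` A) + L * d"
  proof (rule Max_image_le_Max_image_add)
    fix b assume b: "b \<in> B"
    then obtain a where a: "a \<in> A" "mdist P a b \<le> d"
      using hausdorff_leD(2)[OF fin haus] by blast
    have "F b \<le> F a + L * d"
      using close[OF a(1) b a(2)] by linarith
    with a(1) show "\<exists>a\<in>A. F b \<le> F a + L * d" by blast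
  qed (use fin in auto)
  ultimately show ?thesis by linarith
qed

lemma finite_sample_space:
  assumes "valid_system S"
  shows "finite (sample_space S)"
  using assms unfolding sample_space_def valid_system_def
  by (intro finite_cartesian_product finite_PiE) auto

lemma cond_range_eq_image: "cond_range S A B b = A ` {\<omega> \<in> sample_space S. B \<omega> = b}"
  unfolding cond_range_def by blast

lemma finite_cond_range:
  assumes "valid_system S"
  shows "finite (cond_range S A B b)"
  unfolding cond_range_eq_image using finite_sample_space[OF assms] by simp

lemma cond_range_subset: "cond_range S A B b \<subseteq> A ` sample_space S"
  unfolding cond_range_eq_image by blast

text \<open>The information state is a function of the memory. This turns a maximum over reachable
  information states into one over reachable memories, whatever is conditioned on.\<close>

lemma cond_range_info:
  "cond_range S (info S \<sigma> t) B b = \<sigma> t ` cond_range S (memory S t) B b"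
  by (simp add: cond_range_eq_image info_def image_image)

text \<open>The state at time \<open>s\<close> depends only on actions strictly before
  \<open>s\<close>, so the action at any \<open>t\<close> \<ge> \<open>s\<close> may be changed
  freely.\<close>

lemma state_update_action:
  "s \<le> t \<Longrightarrow> state S s (x0, w, n, u(t := a)) = state S s (x0, w, n, u)"
  by (induction s) auto

lemma memory_update_action:
  "memory S t (x0, w, n, u(t := a)) = memory S t (x0, w, n, u)"
  by (auto simp: memory_def state_update_action)

text \<open>The memory at time \<open>t\<close> records actions only up to t - 1. Hence an outcome
  realizing \<open>m\<close> still does so after its action at \<open>t\<close> is overwritten by
  \<open>a\<close>. This makes the conditional ranges below nonempty, so that their
  \<open>Max\<close> is meaningful.\<close>

lemma memory_action_realizable:
  assumes "t \<le> horizon S" "m \<in> memories S t" "a \<in> actions S t"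
  obtains \<omega> where "\<omega> \<in> sample_space S" "memory S t \<omega> = m" "action t \<omega> = a"
proof -
  obtain x0 w n u where u: "(x0, w, n, u) \<in> sample_space S" "memory S t (x0, w, n, u) = m"
    using assms(2) by (auto simp: memories_def)
  show ?thesis
  proof
    show "(x0, w, n, u(t := a)) \<in> sample_space S"
      using u(1) assms(1,3) by (auto simp: sample_space_def PiE_iff extensional_def)
  qed (use u in \<open>auto simp: memory_update_action\<close>)
qed

text \<open>Here \<open>F\<close> is \<open>V_fun\<close> or \<open>Lambda\<close> at time \<open>Suc t\<close>.\<close>

lemma backward_step:
  assumes valid: "valid_system S" and ais: "approx_info_state S P \<sigma> \<epsilon> \<delta>"
    and t: "t < horizon S" and m: "m \<in> memories S t" and u: "u \<in> actions S t"
    and lip: "lipschitz_const (P (Suc t)) (info_range S \<sigma> (Suc t)) L (V_hat S \<sigma> (Suc t))"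
    and F: "\<And>m'. m' \<in> memories S (Suc t) \<Longrightarrow> \<bar>F m' - V_hat S \<sigma> (Suc t) (\<sigma> (Suc t) m')\<bar> \<le> c"
  shows "\<bar>(MAX m' \<in> cond_range S (memory S (Suc t)) (\<lambda>\<omega>. (memory S t \<omega>, action t \<omega>)) (m, u). F m')
           - Q_hat S \<sigma> t (\<sigma> t m) u\<bar> \<le> c + L * \<delta> t"
proof -
  let ?V = "V_hat S \<sigma> (Suc t)"
  \<comment> \<open>\<open>C\<close> holds the successor memories, \<open>A\<close> their
    information states, and \<open>B\<close> the information states reachable when only
    \<open>\<sigma> t m\<close> is known. The comparison runs from \<open>F\<close> on
    \<open>C\<close> to \<open>?V\<close> on \<open>A\<close> (cost \<open>c\<close>), then to
    \<open>?V\<close> on \<open>B\<close> (cost \<open>L * \<delta> t\<close>), which is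
    \<open>Q_hat\<close>.\<close>
  define C where "C = cond_range S (memory S (Suc t)) (\<lambda>\<omega>. (memory S t \<omega>, action t \<omega>)) (m, u)"
  define A where
    "A = cond_range S (info S \<sigma> (Suc t)) (\<lambda>\<omega>. (memory S t \<omega>, action t \<omega>)) (m, u)"
  define B where
    "B = cond_range S (info S \<sigma> (Suc t)) (\<lambda>\<omega>. (info S \<sigma> t \<omega>, action t \<omega>)) (\<sigma> t m, u)"
  obtain \<omega> where \<omega>: "\<omega> \<in> sample_space S" "memory S t \<omega> = m" "action t \<omega> = u"
    using memory_action_realizable[OF less_imp_le[OF t] m u] by blast
  \<comment> \<open>The outcome \<open>\<omega>\<close> contributes to all three sets: an outcome
    with memory \<open>m\<close> has information state \<open>\<sigma> t m\<close>.\<close>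
  have ne: "C \<noteq> {}" "A \<noteq> {}" "B \<noteq> {}"
    using \<omega> unfolding A_def B_def C_def cond_range_eq_image info_def by blast+
  have fin: "finite C" "finite A" "finite B"
    using finite_cond_range[OF valid] by (auto simp: A_def B_def C_def)
  have AC: "A = \<sigma> (Suc t) ` C"
    unfolding A_def C_def by (rule cond_range_info)
  have "C \<subseteq> memories S (Suc t)"
    unfolding C_def memories_def by (rule cond_range_subset)
  then have "\<bar>Max (F ` C) - Max ((\<lambda>m'. ?V (\<sigma> (Suc t) m')) ` C)\<bar> \<le> c"
    using F fin(1) ne(1) by (intro abs_Max_image_diff_le) auto
  then have 1: "\<bar>Max (F ` C) - Max (?V ` A)\<bar> \<le> c"
    by (simp add: AC image_image)
  have "hausdorff (P (Suc t)) A B \<le> \<delta> t"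
    using ais t m u by (auto simp: approx_info_state_def A_def B_def)
  then have 2: "\<bar>Max (?V ` A) - Max (?V ` B)\<bar> \<le> L * \<delta> t"
    using fin ne lip
    by (intro abs_Max_image_diff_le_hausdorff[where D = "info_range S \<sigma> (Suc t)"])
      (simp_all add: A_def B_def cond_range_subset info_range_def)
  have "Q_hat S \<sigma> t (\<sigma> t m) u = Max (?V ` B)"
    using t by (simp add: Q_hat.simps B_def)
  with 1 2 show ?thesis
    unfolding C_def[symmetric] by linarith
qed

text \<open>The pair \<open>q\<close>, \<open>v\<close> stands for \<open>Q_fun\<close>,
  \<open>V_fun\<close> or for \<open>Theta\<close>, \<open>Lambda\<close>. Both obey the same
  recursion for \<open>q\<close>; they differ in how \<open>v\<close> arises from \<open>q\<close>,
  and \<open>v_close\<close> abstracts this as the property that passing to \<open>v\<close> does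
  not increase the error.\<close>

lemma approx_values_close:
  assumes valid: "valid_system S" and ais: "approx_info_state S P \<sigma> \<epsilon> \<delta>"
    and lip: "\<And>t. t < horizon S \<Longrightarrow>
           lipschitz_const (P (Suc t)) (info_range S \<sigma> (Suc t)) (L (Suc t)) (V_hat S \<sigma> (Suc t))"
    and \<alpha>_horizon: "\<alpha> (horizon S) = \<epsilon>"
    and \<alpha>_step: "\<And>t. t < horizon S \<Longrightarrow> \<alpha> t = \<alpha> (Suc t) + L (Suc t) * \<delta> t"
    and q_horizon: "\<And>m u. q (horizon S) m u =
           (MAX x \<in> cond_range S (state S (horizon S)) (memory S (horizon S)) m. terminal_cost S x u)"
    and q_step: "\<And>t m u. t < horizon S \<Longrightarrow> q t m u =
           (MAX m' \<in> cond_range S (memory S (Suc t)) (\<lambda>\<omega>. (memory S t \<omega>, action t \<omega>)) (m, u). v (Suc t) m')"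
    and v_close: "\<And>t m c. t \<le> horizon S \<Longrightarrow> m \<in> memories S t \<Longrightarrow>
           (\<And>u. u \<in> actions S t \<Longrightarrow> \<bar>q t m u - Q_hat S \<sigma> t (\<sigma> t m) u\<bar> \<le> c) \<Longrightarrow>
           \<bar>v t m - V_hat S \<sigma> t (\<sigma> t m)\<bar> \<le> c"
    and "t \<le> horizon S" and "m \<in> memories S t"
  shows "u \<in> actions S t \<Longrightarrow> \<bar>q t m u - Q_hat S \<sigma> t (\<sigma> t m) u\<bar> \<le> \<alpha> t"
    and "\<bar>v t m - V_hat S \<sigma> t (\<sigma> t m)\<bar> \<le> \<alpha> t"
proof -
  \<comment> \<open>Induction runs down from the horizon. The claim quantifies over all memories
    because the step at \<open>t\<close> needs it at every successor memory.\<close>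
  have q_close: "\<forall>m\<in>memories S t. \<forall>u\<in>actions S t. \<bar>q t m u - Q_hat S \<sigma> t (\<sigma> t m) u\<bar> \<le> \<alpha> t"
    using \<open>t \<le> horizon S\<close>
  proof (induction t rule: inc_induct)
    case base
    show ?case
      using ais by (simp add: approx_info_state_def Let_def q_horizon \<alpha>_horizon Q_hat.simps)
  next
    case (step t)
    show ?case
    proof (intro ballI)
      fix m u assume "m \<in> memories S t" "u \<in> actions S t"
      \<comment> \<open>The induction hypothesis concerns \<open>q\<close>; \<open>v_close\<close>
        converts it into the bound on \<open>v\<close> that \<open>backward_step\<close>
        expects.\<close>
      moreover have "\<bar>v (Suc t) m' - V_hat S \<sigma> (Suc t) (\<sigma> (Suc t) m')\<bar> \<le> \<alpha> (Suc t)"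
        if "m' \<in> memories S (Suc t)" for m'
        using step that by (intro v_close) auto
      ultimately show "\<bar>q t m u - Q_hat S \<sigma> t (\<sigma> t m) u\<bar> \<le> \<alpha> t"
        using backward_step[OF valid ais _ _ _ lip] step.hyps by (simp add: q_step \<alpha>_step)
    qed
  qed
  with \<open>m \<in> memories S t\<close>
  show "u \<in> actions S t \<Longrightarrow> \<bar>q t m u - Q_hat S \<sigma> t (\<sigma> t m) u\<bar> \<le> \<alpha> t" by blast
  show "\<bar>v t m - V_hat S \<sigma> t (\<sigma> t m)\<bar> \<le> \<alpha> t"
    using q_close \<open>t \<le> horizon S\<close> \<open>m \<in> memories S t\<close> by (intro v_close) auto
qed

theorem theorem3:
  fixes S :: "('x, 'u, 'w, 'n, 'y) control_system"
    and P :: "nat \<Rightarrow> 'p metric"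
    and \<sigma> :: "nat \<Rightarrow> ('u, 'y) memory \<Rightarrow> 'p"
    and \<epsilon> :: real and \<delta> L \<alpha> :: "nat \<Rightarrow> real"
    and g_hat :: "nat \<Rightarrow> 'p \<Rightarrow> 'u"
    and g :: "nat \<Rightarrow> ('u, 'y) memory \<Rightarrow> 'u"
  assumes "valid_system S"
    and "approx_info_state S P \<sigma> \<epsilon> \<delta>"
    and "\<And>t. t < horizon S \<Longrightarrow>
           lipschitz_const (P (Suc t)) (info_range S \<sigma> (Suc t)) (L (Suc t)) (V_hat S \<sigma> (Suc t))"
    and "\<And>t \<pi>. t \<le> horizon S \<Longrightarrow> \<pi> \<in> info_range S \<sigma> t \<Longrightarrow>
           is_arg_min (Q_hat S \<sigma> t \<pi>) (\<lambda>u. u \<in> actions S t) (g_hat t \<pi>)"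
    and "\<And>t m. t \<le> horizon S \<Longrightarrow> m \<in> memories S t \<Longrightarrow> g t m = g_hat t (\<sigma> t m)"
    and "\<alpha> (horizon S) = \<epsilon>"
    and "\<And>t. t < horizon S \<Longrightarrow> \<alpha> t = \<alpha> (Suc t) + L (Suc t) * \<delta> t"
  shows "\<forall>t\<le>horizon S. \<forall>m\<in>memories S t. \<forall>u\<in>actions S t.
           \<bar>Q_fun S t m u - Theta S g t m u\<bar> \<le> 2 * \<alpha> t \<and>
           \<bar>V_fun S t m - Lambda S g t m\<bar> \<le> 2 * \<alpha> t"
proof (intro allI ballI impI)
  fix t m u
  assume t: "t \<le> horizon S" and m: "m \<in> memories S t" and u: "u \<in> actions S t"
  have actions: "finite (actions S s)" "actions S s \<noteq> {}" if "s \<le> horizon S" for s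
    using assms(1) that by (auto simp: valid_system_def)
  have V_close: "\<bar>V_fun S s m - V_hat S \<sigma> s (\<sigma> s m)\<bar> \<le> c"
    if "s \<le> horizon S" "\<And>u. u \<in> actions S s \<Longrightarrow> \<bar>Q_fun S s m u - Q_hat S \<sigma> s (\<sigma> s m) u\<bar> \<le> c"
    for s m c
    using that actions unfolding V_fun.simps V_hat.simps by (intro abs_Min_image_diff_le) auto
  have Lambda_close: "\<bar>Lambda S g s m - V_hat S \<sigma> s (\<sigma> s m)\<bar> \<le> c"
    if s: "s \<le> horizon S" and m: "m \<in> memories S s"
      and close: "\<And>u. u \<in> actions S s \<Longrightarrow> \<bar>Theta S g s m u - Q_hat S \<sigma> s (\<sigma> s m) u\<bar> \<le> c"
    for s m c
  proof -
    have "\<sigma> s m \<in> info_range S \<sigma> s"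
      using m by (auto simp: memories_def info_range_def info_def)
    then have arg: "is_arg_min (Q_hat S \<sigma> s (\<sigma> s m)) (\<lambda>u. u \<in> actions S s) (g s m)"
      using assms(4)[OF s] assms(5)[OF s m] by simp
    \<comment> \<open>The strategy's action attains the minimum defining \<open>V_hat\<close>, so
      closeness of \<open>Theta\<close> to \<open>Q_hat\<close> at this one admissible action
      already bounds \<open>Lambda\<close>.\<close>
    then have "V_hat S \<sigma> s (\<sigma> s m) = Q_hat S \<sigma> s (\<sigma> s m) (g s m)"
      unfolding V_hat.simps is_arg_min_linorder using actions[OF s] by (intro Min_eqI) auto
    with arg close show ?thesis
      by (simp add: Lambda.simps is_arg_min_def)
  qed
  have Q_horizon: "Q_fun S (horizon S) m u =
      (MAX x \<in> cond_range S (state S (horizon S)) (memory S (horizon S)) m. terminal_cost S x u)"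
    and Theta_horizon: "Theta S g (horizon S) m u =
      (MAX x \<in> cond_range S (state S (horizon S)) (memory S (horizon S)) m. terminal_cost S x u)"
    for m u
    by (simp_all add: Q_fun.simps Theta.simps)
  have Q_step: "Q_fun S s m u = (MAX m' \<in> cond_range S (memory S (Suc s))
      (\<lambda>\<omega>. (memory S s \<omega>, action s \<omega>)) (m, u). V_fun S (Suc s) m')"
    and Theta_step: "Theta S g s m u = (MAX m' \<in> cond_range S (memory S (Suc s))
      (\<lambda>\<omega>. (memory S s \<omega>, action s \<omega>)) (m, u). Lambda S g (Suc s) m')"
    if "s < horizon S" for s m u
    using that by (simp_all add: Q_fun.simps[of S s] Theta.simps[of S g s])
  note Q = approx_values_close[where q = "Q_fun S" and v = "V_fun S",
      OF assms(1-3,6,7) Q_horizon Q_step V_close t m]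
  note Theta = approx_values_close[where q = "Theta S g" and v = "Lambda S g",
      OF assms(1-3,6,7) Theta_horizon Theta_step Lambda_close t m]
  have "\<bar>Q_fun S t m u - Q_hat S \<sigma> t (\<sigma> t m) u\<bar> \<le> \<alpha> t"
    and "\<bar>V_fun S t m - V_hat S \<sigma> t (\<sigma> t m)\<bar> \<le> \<alpha> t"
    by (rule Q; use u in blast)+
  moreover have "\<bar>Theta S g t m u - Q_hat S \<sigma> t (\<sigma> t m) u\<bar> \<le> \<alpha> t"
    and "\<bar>Lambda S g t m - V_hat S \<sigma> t (\<sigma> t m)\<bar> \<le> \<alpha> t"
    by (rule Theta; use u in blast)+
  ultimately show "\<bar>Q_fun S t m u - Theta S g t m u\<bar> \<le> 2 * \<alpha> t \<and>
      \<bar>V_fun S t m - Lambda S g t m\<bar> \<le> 2 * \<alpha> t"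
    by linarith
qed

end
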